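(* Let $n\in\mathbb{N}$ with $n\ge 1$, let $M\in\mathbb{C}^{n\times n}$, and let $M=a1_n^T+1_nb^T+M_0+(\operatorname{wt}M)\,\mathcal{E}_n$, where $a,b\in\mathbb{C}^n$ satisfy $1_n^Ta=1_n^Tb=0$ and $M_0\in\mathbb{C}^{n\times n}$ has all row sums and all column sums equal to $0$. Then $$\det M=(\operatorname{wt}M-1)\,1_n^T\operatorname{adj}\bigl(M_0-ab^T\bigr)1_n+(b+1_n)^T\operatorname{adj}\bigl(M_0-ab^T+(\operatorname{wt}M-1)\,\mathcal{E}_n\bigr)(a+1_n).$$
   Context: Notation: $1_n$ is the column vector of length $n$ with all entries equal to $1$; $\mathcal{E}_n=1_n1_n^T$. For $M=(m_{i,j})\in\mathbb{C}^{n\times n}$, $\operatorname{wt}M=\frac{1}{n^2}\sum_{i,j=1}^n m_{i,j}$. Superscript $T$ denotes the transpose (without complex conjugation). The adjugate is $\operatorname{adj}M=((-1)^{i+j}\det(M_{j,i}))_{i,j=1}^n$, where $M_{j,i}$ is the submatrix of $M$ obtained by deleting row $j$ and column $i$ (the determinant of the empty matrix being $1$). *)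

theory Defs
  imports Complex_Main "Jordan_Normal_Form.Determinant"
begin

definition ones_vec :: "nat \<Rightarrow> complex vec" where
  "ones_vec n = vec n (\<lambda>_. 1)"

(* The matrix u v^T: plain transpose, no complex conjugation. *)
definition outer :: "complex vec \<Rightarrow> complex vec \<Rightarrow> complex mat" where
  "outer u v = mat (dim_vec u) (dim_vec v) (\<lambda>(i, j). u $ i * v $ j)"

definition ones_mat :: "nat \<Rightarrow> complex mat" where
  "ones_mat n = outer (ones_vec n) (ones_vec n)"

(* Intended for square matrices, where dim_row M = dim_col M = n. *)
definition wt :: "complex mat \<Rightarrow> complex" where
  "wt M = 1 / (of_nat (dim_row M))\<^sup>2 * (\<Sum>i<dim_row M. \<Sum>j<dim_col M. M $$ (i, j))"

end

theory Submission
  imports Defs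
begin

text \<open>Writing \<open>w\<close> for the weight of \<open>M\<close> and \<open>N = M\<^sub>0 - a b\<^sup>T\<close>, one has
  \<open>M = (N + (w - 1) 1 1\<^sup>T) + (a + 1)(b + 1)\<^sup>T\<close>. The identity
  \<open>det (A + u v\<^sup>T) = det A + v\<^sup>T (adj A) u\<close>, valid also for singular \<open>A\<close>, is applied to this sum
  and then to \<open>N + (w - 1) 1 1\<^sup>T\<close>; finally \<open>det N = 0\<close> because \<open>N 1 = 0\<close>.\<close>

text \<open>The cofactor at \<open>(k, j)\<close> deletes row \<open>k\<close>, so the entries of
  that row cannot influence it.\<close>

lemma cofactor_cong_row:
  assumes "dim_row A = dim_row B" "dim_col A = dim_col B"
    and "\<And>i j. i < dim_row A \<Longrightarrow> j < dim_col A \<Longrightarrow> i \<noteq> k \<Longrightarrow> A $$ (i, j) = B $$ (i, j)"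
  shows "cofactor A k j = cofactor B k j"
proof -
  have "mat_delete A k j = mat_delete B k j"
    unfolding mat_delete_def using assms by (intro eq_matI) auto
  then show ?thesis by (simp add: cofactor_def)
qed

lemma det_replace_row:
  fixes A :: "'a :: comm_ring_1 mat"
  assumes "A \<in> carrier_mat n n" "k < n"
  shows "det (mat n n (\<lambda>(i, j). if i = k then v $ j else A $$ (i, j))) =
    (\<Sum>j<n. v $ j * cofactor A k j)"
proof -
  let ?B = "mat n n (\<lambda>(i, j). if i = k then v $ j else A $$ (i, j))"
  have "det ?B = (\<Sum>j<n. ?B $$ (k, j) * cofactor ?B k j)"
    by (rule laplace_expansion_row) (use assms in auto)
  also have "\<dots> = (\<Sum>j<n. v $ j * cofactor A k j)"
  proof (rule sum.cong[OF refl])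
    fix j assume "j \<in> {..<n}"
    moreover have "cofactor ?B k j = cofactor A k j"
      by (rule cofactor_cong_row) (use assms in auto)
    ultimately show "?B $$ (k, j) * cofactor ?B k j = v $ j * cofactor A k j"
      using assms by simp
  qed
  finally show ?thesis .
qed

text \<open>Row \<open>k\<close> equals \<open>v\<close>, so every other row receives only a
  multiple of row \<open>k\<close>, which leaves the determinant unchanged. The bound
  \<open>m\<close> lets the induction treat one row at a time.\<close>

lemma det_replace_row_add_multiples:
  fixes A :: "'a :: comm_ring_1 mat"
  assumes "A \<in> carrier_mat n n" "k < n" "m \<le> n"
  shows "det (mat n n (\<lambda>(i, j). if i = k then v $ j
      else A $$ (i, j) + (if i < m then u $ i * v $ j else 0))) =
    det (mat n n (\<lambda>(i, j). if i = k then v $ j else A $$ (i, j)))"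
    (is "det (?G m) = _")
  using assms(3)
proof (induction m)
  case 0
  show ?case by (intro arg_cong[where f = det] eq_matI) auto
next
  case (Suc m)
  show ?case
  \<comment> \<open>For \<open>m = k\<close> the override by \<open>v\<close> hides the new summand;
    otherwise the step is the row operation adding \<open>u $ m\<close> times row \<open>k\<close>
    to row \<open>m\<close>.\<close>
  proof (cases "m = k")
    case True
    then have "?G (Suc m) = ?G m" by (intro eq_matI) (auto simp: less_Suc_eq)
    then show ?thesis using Suc by simp
  next
    case False
    have "?G (Suc m) = addrow (u $ m) m k (?G m)"
      using False assms Suc.prems
      by (intro eq_matI) (auto simp: less_Suc_eq algebra_simps)
    moreover have "det (addrow (u $ m) m k (?G m)) = det (?G m)"
      by (rule det_addrow[where n = n]) (use False assms in auto)
    ultimately show ?thesis using Suc by simp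
  qed
qed

text \<open>The rows are updated one by one. By linearity in row \<open>m\<close>, its update adds
  \<open>u $ m\<close> times the determinant with row \<open>m\<close> replaced by \<open>v\<close>;
  there the earlier updates are multiples of row \<open>m\<close> and can be removed, so only
  cofactors of the original \<open>A\<close> appear.\<close>

lemma det_add_outer_rows:
  fixes A :: "'a :: comm_ring_1 mat"
  assumes A: "A \<in> carrier_mat n n" and "m \<le> n"
  shows "det (mat n n (\<lambda>(i, j). A $$ (i, j) + (if i < m then u $ i * v $ j else 0))) =
    det A + (\<Sum>i<m. u $ i * (\<Sum>j<n. v $ j * cofactor A i j))"
    (is "det (?H m) = _")
  using \<open>m \<le> n\<close>
proof (induction m)
  case 0
  have "?H 0 = A" using A by (intro eq_matI) auto
  then show ?case by simp
next
  case (Suc m)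
  then have m: "m < n" by simp
  \<comment> \<open>The two matrices differ in row \<open>m\<close> only.\<close>
  have cof: "cofactor (?H (Suc m)) m j = cofactor (?H m) m j" for j
    by (rule cofactor_cong_row) (auto simp: less_Suc_eq)
  have "det (?H (Suc m)) = (\<Sum>j<n. ?H (Suc m) $$ (m, j) * cofactor (?H (Suc m)) m j)"
    by (rule laplace_expansion_row) (use m in auto)
  also have "\<dots> = (\<Sum>j<n. ?H m $$ (m, j) * cofactor (?H m) m j)
      + u $ m * (\<Sum>j<n. v $ j * cofactor (?H m) m j)"
    unfolding cof sum_distrib_left sum.distrib[symmetric]
    by (rule sum.cong[OF refl]) (use m in \<open>auto simp: algebra_simps\<close>)
  also have "(\<Sum>j<n. ?H m $$ (m, j) * cofactor (?H m) m j) = det (?H m)"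
    by (rule laplace_expansion_row[symmetric]) (use m in auto)
  also have "(\<Sum>j<n. v $ j * cofactor (?H m) m j) =
      det (mat n n (\<lambda>(i, j). if i = m then v $ j else ?H m $$ (i, j)))"
    by (rule det_replace_row[symmetric]) (use m in auto)
  also have "mat n n (\<lambda>(i, j). if i = m then v $ j else ?H m $$ (i, j)) =
      mat n n (\<lambda>(i, j). if i = m then v $ j
        else A $$ (i, j) + (if i < m then u $ i * v $ j else 0))"
    by (intro eq_matI) auto
  \<comment> \<open>Row \<open>m\<close> is now \<open>v\<close>, so the updates of the rows above
    it drop out.\<close>
  also have "det \<dots> = (\<Sum>j<n. v $ j * cofactor A m j)"
    using det_replace_row_add_multiples[OF A m, of m v u] det_replace_row[OF A m, of v] m by simp
  finally show ?case using Suc by (simp add: algebra_simps)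
qed

text \<open>This is the case \<open>m = n\<close> of the row-wise formula. The sums are swapped
  because the adjugate is the transpose of the cofactor matrix.\<close>

lemma det_add_outer:
  assumes A: "A \<in> carrier_mat n n" and u: "u \<in> carrier_vec n" and v: "v \<in> carrier_vec n"
  shows "det (A + outer u v) = det A + v \<bullet> (adj_mat A *\<^sub>v u)"
proof -
  have "A + outer u v =
      mat n n (\<lambda>(i, j). A $$ (i, j) + (if i < n then u $ i * v $ j else 0))"
    using assms by (intro eq_matI) (auto simp: outer_def)
  then have "det (A + outer u v) =
      det A + (\<Sum>i<n. u $ i * (\<Sum>j<n. v $ j * cofactor A i j))"
    using det_add_outer_rows[OF A order.refl, of u v] by simp
  also have "(\<Sum>i<n. u $ i * (\<Sum>j<n. v $ j * cofactor A i j)) =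
      (\<Sum>i<n. \<Sum>j<n. v $ j * (cofactor A i j * u $ i))"
    by (simp add: sum_distrib_left algebra_simps)
  also have "\<dots> = (\<Sum>j<n. \<Sum>i<n. v $ j * (cofactor A i j * u $ i))"
    by (rule sum.swap)
  also have "\<dots> = v \<bullet> (adj_mat A *\<^sub>v u)"
    using assms
    by (auto simp: scalar_prod_def adj_mat_def sum_distrib_left lessThan_atLeast0 intro!: sum.cong)
  finally show ?thesis .
qed

text \<open>The all-ones vector lies in the kernel, and it is nonzero since
  \<open>n \<ge> 1\<close>.\<close>

lemma det_eq_0_if_row_sums_0:
  fixes A :: "complex mat"
  assumes A: "A \<in> carrier_mat n n" and "n \<ge> 1"
    and "\<And>i. i < n \<Longrightarrow> (\<Sum>j<n. A $$ (i, j)) = 0"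
  shows "det A = 0"
proof -
  have "A *\<^sub>v ones_vec n = 0\<^sub>v n"
    using assms by (intro eq_vecI) (auto simp: scalar_prod_def ones_vec_def lessThan_atLeast0)
  moreover have "ones_vec n \<noteq> 0\<^sub>v n"
  proof
    assume "ones_vec n = 0\<^sub>v n"
    then have "ones_vec n $ 0 = 0\<^sub>v n $ 0" by simp
    then show False using \<open>n \<ge> 1\<close> by (simp add: ones_vec_def)
  qed
  moreover have "ones_vec n \<in> carrier_vec n" by (simp add: ones_vec_def)
  ultimately show ?thesis using det_0_iff_vec_prod_zero[OF A] by blast
qed

theorem mainTheorem5:
  fixes n :: nat and M M0 :: "complex mat" and a b :: "complex vec"
  assumes "n \<ge> 1"
    and "M \<in> carrier_mat n n"
    and "a \<in> carrier_vec n" and "b \<in> carrier_vec n"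
    and "ones_vec n \<bullet> a = 0" and "ones_vec n \<bullet> b = 0"
    and "M0 \<in> carrier_mat n n"
    and "\<forall>i<n. (\<Sum>j<n. M0 $$ (i, j)) = 0"
    and "\<forall>j<n. (\<Sum>i<n. M0 $$ (i, j)) = 0"
    and "M = outer a (ones_vec n) + outer (ones_vec n) b + M0 + wt M \<cdot>\<^sub>m ones_mat n"
  shows "det M =
    (wt M - 1) * (ones_vec n \<bullet> (adj_mat (M0 - outer a b) *\<^sub>v ones_vec n))
    + (b + ones_vec n) \<bullet>
        (adj_mat (M0 - outer a b + (wt M - 1) \<cdot>\<^sub>m ones_mat n) *\<^sub>v (a + ones_vec n))"
proof -
  define w where "w = wt M"
  define N where "N = M0 - outer a b"
  let ?one = "ones_vec n"
  have one: "?one \<in> carrier_vec n" by (simp add: ones_vec_def)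
  have N: "N \<in> carrier_mat n n" using assms(3,4,7) unfolding N_def outer_def by (intro minus_carrier_mat) simp
  \<comment> \<open>Absorbing the scalar into the left vector gives the shape
    \<open>outer u v\<close> needed for the second rank-one update.\<close>
  have ones: "(w - 1) \<cdot>\<^sub>m ones_mat n = outer ((w - 1) \<cdot>\<^sub>v ?one) ?one"
    by (intro eq_matI) (auto simp: ones_mat_def outer_def ones_vec_def)
  have NE: "N + (w - 1) \<cdot>\<^sub>m ones_mat n \<in> carrier_mat n n"
    using N by (simp add: ones_mat_def outer_def ones_vec_def)
  have "M = outer a ?one + outer ?one b + M0 + w \<cdot>\<^sub>m ones_mat n"
    using assms(10) by (simp add: w_def)
  \<comment> \<open>Expanding \<open>outer (a + ?one) (b + ?one)\<close> yields an
    \<open>outer a b\<close> that cancels the one in \<open>N\<close>, and one copy of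
    \<open>ones_mat n\<close>, which is why \<open>w\<close> drops to \<open>w - 1\<close>.\<close>
  also have "\<dots> = N + (w - 1) \<cdot>\<^sub>m ones_mat n + outer (a + ?one) (b + ?one)"
    using assms(3,4,7)
    by (intro eq_matI) (auto simp: N_def ones_mat_def outer_def ones_vec_def algebra_simps)
  finally have "det M = det (N + (w - 1) \<cdot>\<^sub>m ones_mat n)
      + (b + ?one) \<bullet> (adj_mat (N + (w - 1) \<cdot>\<^sub>m ones_mat n) *\<^sub>v (a + ?one))"
    using det_add_outer[OF NE, of "a + ?one" "b + ?one"] assms(3,4) one by simp
  moreover have "det (N + (w - 1) \<cdot>\<^sub>m ones_mat n) =
      det N + (w - 1) * (?one \<bullet> (adj_mat N *\<^sub>v ?one))"
    unfolding ones using det_add_outer[OF N, of "(w - 1) \<cdot>\<^sub>v ?one" ?one] one adj_mat(1)[OF N]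
    by (simp add: mult_mat_vec)
  moreover have "det N = 0"
  proof (rule det_eq_0_if_row_sums_0[OF N assms(1)])
    fix i assume i: "i < n"
    \<comment> \<open>Subtracting \<open>outer a b\<close> keeps the row sums zero because the
      entries of \<open>b\<close> sum to 0.\<close>
    have "(\<Sum>j<n. N $$ (i, j)) = (\<Sum>j<n. M0 $$ (i, j)) - a $ i * (\<Sum>j<n. b $ j)"
      using i assms(3,4,7) by (simp add: N_def outer_def sum_subtractf sum_distrib_left)
    also have "(\<Sum>j<n. b $ j) = ?one \<bullet> b"
      using assms(4) by (simp add: scalar_prod_def ones_vec_def lessThan_atLeast0)
    finally show "(\<Sum>j<n. N $$ (i, j)) = 0" using assms(6,8) i by simp
  qed
  ultimately show ?thesis by (simp add: w_def N_def)
qed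

end
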